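(* Let $R$ be an integral domain of characteristic $0$ containing $\mathbb{Q}$. Let $N\ge2$, let $q(Y)\in R[Y]$ be nonzero, let $t=(t_1,\ldots,t_N)\in R^N$ with not all coordinates $0$, let $c\in R$, and let $n\ge0$ be an integer. Put $q_t=q(t_1X_1+\cdots+t_NX_N)\in R[X_1,\ldots,X_N]$ and $t\cdot t=t_1^2+\cdots+t_N^2$. Then the harmonic polynomial $L_cq_t$ is homogeneous of degree $n$ if and only if $q$ satisfies the differential equation $$[(t\cdot t)c-Y^2]\,q''(Y)-(N-1)Y\,q'(Y)+n(n+N-2)\,q(Y)=0.$$
   Context: A polynomial $p\in R[X_1,\ldots,X_N]$ is harmonic if $\Delta_Np=0$, where $\Delta_N=\sum_{j=1}^N\partial^2/\partial X_j^2$. For $R$ containing $\mathbb{Q}$ and $c\in R$, $L_c\colon R[X_1,\ldots,X_N]\to\ker\Delta_N$ denotes the unique $R$-linear map that restricts to the identity on harmonic polynomials and vanishes on the ideal generated by $X_1^2+\cdots+X_N^2-c$ (it exists and is unique; $L_cp$ is the unique harmonic polynomial congruent to $p$ modulo this ideal). "Homogeneous of degree $n$" includes being nonzero. *)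

theory Defs
  imports
    "HOL-Library.Poly_Mapping"
    "HOL-Computational_Algebra.Polynomial"
    "HOL-Analysis.Finite_Cartesian_Product"
begin

definition contains_rat :: "'a::ring_1 itself \<Rightarrow> bool" where
  "contains_rat _ \<longleftrightarrow> (\<exists>h :: rat \<Rightarrow> 'a. inj h \<and> h 1 = 1 \<and>
     (\<forall>x y. h (x + y) = h x + h y) \<and> (\<forall>x y. h (x * y) = h x * h y))"

text \<open>
  Polynomials over \<open>'a\<close> in variables indexed by a finite type \<open>'n\<close>: finitely supported
  functions from exponent vectors to coefficients, with the convolution product of
  \<^theory>\<open>HOL-Library.Poly_Mapping\<close>. The number of variables is \<open>CARD('n)\<close>.
\<close>

type_synonym ('n, 'a) mpol = "('n \<Rightarrow>\<^sub>0 nat) \<Rightarrow>\<^sub>0 'a"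

definition mconst :: "'a::comm_ring_1 \<Rightarrow> ('n::finite, 'a) mpol" where
  "mconst a = Poly_Mapping.single 0 a"

definition mvar :: "'n::finite \<Rightarrow> ('n, 'a::comm_ring_1) mpol" where
  "mvar j = Poly_Mapping.single (Poly_Mapping.single j 1) 1"

text \<open>
  The subtraction of exponent vectors is truncated, but where it truncates the coefficient
  contains the factor \<open>0\<close>.
\<close>

definition mpderiv :: "'n::finite \<Rightarrow> ('n, 'a::comm_ring_1) mpol \<Rightarrow> ('n, 'a) mpol" where
  "mpderiv j p = (\<Sum>m\<in>Poly_Mapping.keys p.
     Poly_Mapping.single (m - Poly_Mapping.single j 1)
       (of_nat (Poly_Mapping.lookup m j) * Poly_Mapping.lookup p m))"

definition laplacian :: "('n::finite, 'a::comm_ring_1) mpol \<Rightarrow> ('n, 'a) mpol" where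
  "laplacian p = (\<Sum>j\<in>UNIV. mpderiv j (mpderiv j p))"

definition harmonic :: "('n::finite, 'a::comm_ring_1) mpol \<Rightarrow> bool" where
  "harmonic p \<longleftrightarrow> laplacian p = 0"

definition homogeneous_of_degree :: "nat \<Rightarrow> ('n::finite, 'a::comm_ring_1) mpol \<Rightarrow> bool" where
  "homogeneous_of_degree n p \<longleftrightarrow> p \<noteq> 0 \<and>
     (\<forall>m\<in>Poly_Mapping.keys p. (\<Sum>j\<in>UNIV. Poly_Mapping.lookup m j) = n)"

definition sphere_ideal :: "'a::comm_ring_1 \<Rightarrow> ('n::finite, 'a) mpol set" where
  "sphere_ideal c = {((\<Sum>j\<in>UNIV. mvar j ^ 2) - mconst c) * p | p. True}"

text \<open>
  The codomain \<open>ker \<Delta>\<close> of the projection is expressed by the range condition. Existence and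
  uniqueness of the map need the rationals to be contained in the coefficient ring.
\<close>

definition is_harmonic_proj ::
    "'a::comm_ring_1 \<Rightarrow> (('n::finite, 'a) mpol \<Rightarrow> ('n, 'a) mpol) \<Rightarrow> bool" where
  "is_harmonic_proj c L \<longleftrightarrow>
     module_hom (\<lambda>a p. mconst a * p) (\<lambda>a p. mconst a * p) L \<and>
     range L \<subseteq> {p. harmonic p} \<and>
     (\<forall>p. harmonic p \<longrightarrow> L p = p) \<and>
     (\<forall>p\<in>sphere_ideal c. L p = 0)"

definition harmonic_proj ::
    "'a::comm_ring_1 \<Rightarrow> ('n::finite, 'a) mpol \<Rightarrow> ('n, 'a) mpol" where
  "harmonic_proj c = (THE L. is_harmonic_proj c L)"

definition ridge :: "'a::comm_ring_1 poly \<Rightarrow> 'a ^ 'n::finite \<Rightarrow> ('n, 'a) mpol" where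
  "ridge q t = poly (map_poly mconst q) (\<Sum>j\<in>UNIV. mconst (t $ j) * mvar j)"

definition dot_self :: "'a::comm_ring_1 ^ 'n::finite \<Rightarrow> 'a" where
  "dot_self t = (\<Sum>j\<in>UNIV. (t $ j) ^ 2)"

end

theory Submission
  imports "HOL-Algebra.Algebraic_Closure_Type" Defs
begin

text \<open>
  Write \<open>\<rho> = X\<^sub>1\<^sup>2 + \<dots> + X\<^sub>N\<^sup>2\<close> and let \<open>E\<close> be the Euler operator. The spherical Laplacian
  \<open>\<rho> \<Delta> - E (E + N - 2)\<close> commutes with multiplication by \<open>\<rho> - c\<close>, and on harmonic polynomials it has
  the homogeneous ones of degree \<open>n\<close> as eigenvectors with eigenvalue \<open>- n (n + N - 2)\<close>. Modulo
  \<open>\<rho> - c\<close> the polynomial \<open>q\<^sub>t\<close> is congruent to \<open>L\<^sub>c q\<^sub>t\<close>, and there the operator acts on ridge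
  polynomials by the differential operator of the statement. Hence \<open>L\<^sub>c q\<^sub>t\<close> is an eigenvector iff
  \<open>\<rho> - c\<close> divides \<open>r\<^sub>t\<close>, where \<open>r\<close> is the left-hand side of the differential equation; and
  \<open>\<rho> - c\<close> divides no nonzero ridge polynomial.
\<close>

section \<open>Partial derivatives and the Laplacian on polynomials\<close>

definition mdeg :: "('n::finite \<Rightarrow>\<^sub>0 nat) \<Rightarrow> nat" where
  "mdeg m = (\<Sum>j\<in>UNIV. Poly_Mapping.lookup m j)"

lemma mdeg_add: "mdeg (m + k) = mdeg m + mdeg k"
  by (simp add: mdeg_def lookup_add sum.distrib)

lemma mdeg_single [simp]: "mdeg (Poly_Mapping.single j k) = k"
  by (simp add: mdeg_def lookup_single when_def)

text \<open>Every polynomial is a finite sum of monomials, so an additive identity need only be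
  checked on monomials; for a bilinear one the rule is applied twice.\<close>

lemma mpol_induct [case_names monomial add]:
  fixes p :: "('n::finite, 'a::comm_ring_1) mpol"
  assumes single: "\<And>m a. P (Poly_Mapping.single m a)"
    and add: "\<And>p q. P p \<Longrightarrow> P q \<Longrightarrow> P (p + q)"
  shows "P p"
proof -
  have "P (\<Sum>m\<in>A. Poly_Mapping.single m (Poly_Mapping.lookup p m))" if "finite A" for A
    using that
  proof (induction A)
    case empty
    show ?case using single[of 0 0] by simp
  next
    case (insert m A)
    then show ?case by (simp add: single add)
  qed
  moreover have "p = (\<Sum>m\<in>Poly_Mapping.keys p. Poly_Mapping.single m (Poly_Mapping.lookup p m))"
    by (rule poly_mapping_eqI)
      (simp add: lookup_sum lookup_single when_def in_keys_iff)
  ultimately show ?thesis by (metis finite_keys)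
qed

lemma lookup_mpderiv:
  "Poly_Mapping.lookup (mpderiv j p) m =
     of_nat (Suc (Poly_Mapping.lookup m j)) * Poly_Mapping.lookup p (m + Poly_Mapping.single j 1)"
proof -
  let ?e = "Poly_Mapping.single j (1::nat)"
  \<comment> \<open>Truncated subtraction sends both \<open>m + ?e\<close> and possibly some
    \<open>k\<close> with zero entry at \<open>j\<close> to \<open>m\<close>; the latter carry the
    factor 0.\<close>
  have shift: "k - ?e = m \<and> Poly_Mapping.lookup k j \<noteq> 0 \<longleftrightarrow> k = m + ?e" for k
    by (auto simp: poly_mapping_eq_iff fun_eq_iff lookup_add lookup_minus lookup_single when_def
        split: if_splits) 
  have "Poly_Mapping.lookup (mpderiv j p) m = (\<Sum>k\<in>Poly_Mapping.keys p.
      (of_nat (Poly_Mapping.lookup k j) * Poly_Mapping.lookup p k when k - ?e = m))"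
    by (simp add: mpderiv_def lookup_sum lookup_single)
  also have "\<dots> = (\<Sum>k\<in>Poly_Mapping.keys p.
      (of_nat (Suc (Poly_Mapping.lookup m j)) * Poly_Mapping.lookup p (m + ?e) when k = m + ?e))"
  proof (intro sum.cong refl)
    fix k
    show "(of_nat (Poly_Mapping.lookup k j) * Poly_Mapping.lookup p k when k - ?e = m) =
        (of_nat (Suc (Poly_Mapping.lookup m j)) * Poly_Mapping.lookup p (m + ?e) when k = m + ?e)"
      using shift[of k]
      by (cases "k = m + ?e"; cases "Poly_Mapping.lookup k j = 0") (simp_all add: lookup_add when_def)
  qed
  also have "\<dots> = of_nat (Suc (Poly_Mapping.lookup m j)) * Poly_Mapping.lookup p (m + ?e)"
    by (auto simp: when_def in_keys_iff)
  finally show ?thesis .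
qed

lemma mpderiv_add: "mpderiv j (p + q) = mpderiv j p + mpderiv j q"
  by (rule poly_mapping_eqI) (simp add: lookup_mpderiv lookup_add algebra_simps)

lemma mpderiv_single:
  "mpderiv j (Poly_Mapping.single m a) =
     Poly_Mapping.single (m - Poly_Mapping.single j 1) (of_nat (Poly_Mapping.lookup m j) * a)"
  by (cases "a = 0") (simp_all add: mpderiv_def)

lemma mpderiv_zero [simp]: "mpderiv j 0 = 0"
  by (simp add: mpderiv_def)

lemma mpderiv_mult: "mpderiv j (p * q) = mpderiv j p * q + p * mpderiv j q"
proof (induction p rule: mpol_induct)
  case (monomial m a)
  show ?case
  proof (induction q rule: mpol_induct)
    case (monomial k b)
    let ?e = "Poly_Mapping.single j (1::nat)"
    have 1: "m - ?e + k = m + k - ?e" if "Poly_Mapping.lookup m j \<noteq> 0"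
      using that by (auto simp: poly_mapping_eq_iff fun_eq_iff lookup_add lookup_minus
          lookup_single when_def)
    have 2: "m + (k - ?e) = m + k - ?e" if "Poly_Mapping.lookup k j \<noteq> 0"
      using that by (auto simp: poly_mapping_eq_iff fun_eq_iff lookup_add lookup_minus
          lookup_single when_def)
    show ?case
      using 1 2 by (cases "Poly_Mapping.lookup m j = 0"; cases "Poly_Mapping.lookup k j = 0")
        (simp_all add: mpderiv_single mult_single lookup_add algebra_simps flip: single_add)
  next
    case (add p q)
    then show ?case by (simp add: mpderiv_add algebra_simps)
  qed
next
  case (add p q)
  then show ?case by (simp add: mpderiv_add algebra_simps)
qed

lemma mpderiv_sum: "mpderiv j (\<Sum>i\<in>A. f i) = (\<Sum>i\<in>A. mpderiv j (f i))"
  by (induction A rule: infinite_finite_induct) (simp_all add: mpderiv_add)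

lemma mpderiv_mconst [simp]: "mpderiv j (mconst a) = 0"
  by (simp add: mconst_def mpderiv_single)

lemma mpderiv_mvar: "mpderiv j (mvar k) = (if j = k then 1 else 0)"
  by (simp add: mvar_def mpderiv_single lookup_single when_def single_one)

lemma lookup_mconst_mult:
  "Poly_Mapping.lookup (mconst a * p) m = a * Poly_Mapping.lookup p m"
  by (induction p rule: mpol_induct)
    (auto simp: mconst_def mult_single lookup_single when_def lookup_add algebra_simps)

lemma mconst_0 [simp]: "mconst 0 = 0"
  by (simp add: mconst_def)

lemma mconst_1 [simp]: "mconst 1 = 1"
  by (simp add: mconst_def)

lemma mconst_add: "mconst (a + b) = mconst a + mconst b"
  by (simp add: mconst_def single_add)

lemma mconst_mult: "mconst (a * b) = mconst a * mconst b"
  by (simp add: mconst_def mult_single)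

lemma mconst_of_nat [simp]: "mconst (of_nat k) = of_nat k"
  by (simp add: mconst_def)

lemma mconst_sum: "mconst (\<Sum>i\<in>A. f i) = (\<Sum>i\<in>A. mconst (f i))"
  by (induction A rule: infinite_finite_induct) (simp_all add: mconst_add)

lemma laplacian_add: "laplacian (p + q) = laplacian p + laplacian q"
  by (simp add: laplacian_def mpderiv_add sum.distrib)

lemma laplacian_0 [simp]: "laplacian 0 = 0"
  by (simp add: laplacian_def)

lemma laplacian_mconst_mult: "laplacian (mconst a * p) = mconst a * laplacian p"
  by (simp add: laplacian_def mpderiv_mult sum_distrib_left)

lemma laplacian_diff: "laplacian (p - q) = laplacian p - laplacian q"
  using laplacian_add[of "p - q" q] by simp

section \<open>Operators acting by scalars on homogeneous parts\<close>

text \<open>This is \<open>a(E)\<close> for the Euler operator \<open>E\<close>. Arbitrary weights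
  are allowed because inverses of integer polynomials in \<open>E\<close> are needed as well as the
  polynomials themselves.\<close>

definition degree_scale ::
    "(nat \<Rightarrow> 'a) \<Rightarrow> ('n::finite, 'a::comm_ring_1) mpol \<Rightarrow> ('n, 'a) mpol" where
  "degree_scale a p = Poly_Mapping.mapp (\<lambda>m x. a (mdeg m) * x) p"

lemma lookup_degree_scale:
  "Poly_Mapping.lookup (degree_scale a p) m = a (mdeg m) * Poly_Mapping.lookup p m"
  by (simp add: degree_scale_def lookup_mapp when_def in_keys_iff)

lemma degree_scale_add: "degree_scale a (p + q) = degree_scale a p + degree_scale a q"
  by (rule poly_mapping_eqI) (simp add: lookup_degree_scale lookup_add algebra_simps)

lemma degree_scale_diff: "degree_scale a (p - q) = degree_scale a p - degree_scale a q"
  by (rule poly_mapping_eqI) (simp add: lookup_degree_scale lookup_minus algebra_simps)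

lemma degree_scale_0 [simp]: "degree_scale a 0 = 0"
  by (rule poly_mapping_eqI) (simp add: lookup_degree_scale)

lemma degree_scale_plus: "degree_scale (\<lambda>s. a s + b s) p = degree_scale a p + degree_scale b p"
  by (rule poly_mapping_eqI) (simp add: lookup_degree_scale lookup_add algebra_simps)

lemma degree_scale_const: "degree_scale (\<lambda>_. a) p = mconst a * p"
  by (rule poly_mapping_eqI) (simp add: lookup_degree_scale lookup_mconst_mult)

lemma degree_scale_comp:
  "degree_scale a (degree_scale b p) = degree_scale (\<lambda>s. a s * b s) p"
  by (rule poly_mapping_eqI) (simp add: lookup_degree_scale algebra_simps)

lemma degree_scale_single:
  "degree_scale a (Poly_Mapping.single m b) = Poly_Mapping.single m (a (mdeg m) * b)"
  by (rule poly_mapping_eqI) (simp add: lookup_degree_scale lookup_single when_def)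

lemma degree_scale_mconst_mult:
  "degree_scale a (mconst b * p) = mconst b * degree_scale a p"
  by (rule poly_mapping_eqI) (simp add: lookup_degree_scale lookup_mconst_mult)

lemma degree_scale_mvar_mult:
  "degree_scale a (mvar j * p) = mvar j * degree_scale (\<lambda>s. a (Suc s)) p"
  by (induction p rule: mpol_induct)
    (simp_all add: mvar_def mult_single degree_scale_single degree_scale_add mdeg_add algebra_simps)

lemma mpderiv_degree_scale:
  "mpderiv j (degree_scale a p) = degree_scale (\<lambda>s. a (Suc s)) (mpderiv j p)"
  by (rule poly_mapping_eqI) (simp add: lookup_degree_scale lookup_mpderiv mdeg_add algebra_simps)

lemma degree_scale_sum: "degree_scale a (\<Sum>i\<in>A. f i) = (\<Sum>i\<in>A. degree_scale a (f i))"
  by (induction A rule: infinite_finite_induct) (simp_all add: degree_scale_add)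

lemma laplacian_degree_scale:
  "laplacian (degree_scale a p) = degree_scale (\<lambda>s. a (s + 2)) (laplacian p)"
  by (simp add: laplacian_def mpderiv_degree_scale degree_scale_sum)

lemma single_sum:
  "Poly_Mapping.single m (\<Sum>i\<in>A. f i) = (\<Sum>i\<in>A. Poly_Mapping.single m (f i))"
  by (induction A rule: infinite_finite_induct) (simp_all add: single_add)

text \<open>Each \<open>mvar j * mpderiv j\<close> multiplies a monomial by its exponent at
  \<open>j\<close>, and the exponents add up to the degree.\<close>

lemma euler: "(\<Sum>j\<in>UNIV. mvar j * mpderiv j p) = degree_scale of_nat p"
proof (induction p rule: mpol_induct)
  case (monomial m a)
  have "mvar j * mpderiv j (Poly_Mapping.single m a) =
      Poly_Mapping.single m (of_nat (Poly_Mapping.lookup m j) * a)" for j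
  proof (cases "Poly_Mapping.lookup m j = 0")
    case False
    then have "Poly_Mapping.single j 1 + (m - Poly_Mapping.single j 1) = m"
      by (auto simp: poly_mapping_eq_iff fun_eq_iff lookup_add lookup_minus lookup_single when_def)
    then show ?thesis by (simp add: mvar_def mpderiv_single mult_single)
  qed (simp add: mpderiv_single)
  then show ?case
    by (simp add: degree_scale_single mdeg_def sum_distrib_right flip: single_sum)
next
  case (add p q)
  then show ?case by (simp add: mpderiv_add degree_scale_add algebra_simps sum.distrib)
qed


section \<open>Commutators of Laplacian powers with \<open>sq_norm\<close>\<close>

definition sq_norm :: "('n::finite, 'a::comm_ring_1) mpol" where
  "sq_norm = (\<Sum>j\<in>UNIV. mvar j ^ 2)"

lemma degree_scale_sq_norm_mult:
  "degree_scale a (sq_norm * p) = sq_norm * degree_scale (\<lambda>s. a (s + 2)) p"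
  by (simp add: sq_norm_def sum_distrib_right degree_scale_sum power2_eq_square mult.assoc
      degree_scale_mvar_mult)

lemma mpderiv_sq_norm: "mpderiv j (sq_norm :: ('n::finite, 'a::comm_ring_1) mpol) = 2 * mvar j"
proof -
  have "mpderiv j (sq_norm :: ('n, 'a) mpol) = (\<Sum>k\<in>UNIV. if j = k then 2 * mvar k else 0)"
    unfolding sq_norm_def mpderiv_sum
    by (intro sum.cong refl) (simp add: power2_eq_square mpderiv_mult mpderiv_mvar)
  then show ?thesis by simp
qed

text \<open>The commutator of \<Delta> with \<rho> is \<open>4 E + 2 N\<close>: in the product rule
  the mixed terms \<open>4 X_j d_j\<close> sum to \<open>4 E\<close>, and the second derivatives of
  \<rho> contribute 2 for each variable.\<close>

lemma laplacian_sq_norm_mult: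
  fixes p :: "('n::finite, 'a::comm_ring_1) mpol"
  shows "laplacian (sq_norm * p) =
    sq_norm * laplacian p + degree_scale (\<lambda>s. of_nat (4 * s + 2 * CARD('n))) p"
proof -
  have "mpderiv j (mpderiv j (sq_norm * p)) =
      sq_norm * mpderiv j (mpderiv j p) + (2 * p + 4 * (mvar j * mpderiv j p))" for j
  proof -
    have "mpderiv j 2 = (0 :: ('n, 'a) mpol)"
      using mpderiv_mconst[of j "of_nat 2 :: 'a"] unfolding mconst_of_nat by simp
    then show ?thesis
      by (simp add: mpderiv_mult mpderiv_add mpderiv_sq_norm mpderiv_mvar algebra_simps)
  qed
  then have "laplacian (sq_norm * p) =
      sq_norm * laplacian p + (of_nat (2 * CARD('n)) * p + 4 * degree_scale of_nat p)"
    by (simp add: laplacian_def sum.distrib sum_distrib_left flip: euler)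
  also have "of_nat (2 * CARD('n)) * p + 4 * degree_scale of_nat p =
      degree_scale (\<lambda>s. of_nat (4 * s + 2 * CARD('n))) p"
  proof -
    have "of_nat (2 * CARD('n)) * p + of_nat 4 * degree_scale of_nat p =
        degree_scale (\<lambda>s. of_nat (4 * s + 2 * CARD('n))) p"
      unfolding mconst_of_nat[symmetric]
      by (rule poly_mapping_eqI)
        (simp only: lookup_add lookup_degree_scale lookup_mconst_mult, simp add: algebra_simps)
    then show ?thesis by simp
  qed
  finally show ?thesis .
qed

lemma laplacian_pow_diff: "(laplacian ^^ k) (p - q) = (laplacian ^^ k) p - (laplacian ^^ k) q"
  by (induction k) (simp_all add: laplacian_diff)

lemma laplacian_pow_mconst_mult: "(laplacian ^^ k) (mconst a * p) = mconst a * (laplacian ^^ k) p"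
  by (induction k) (simp_all add: laplacian_mconst_mult)

lemma laplacian_pow_0 [simp]: "(laplacian ^^ k) 0 = 0"
  by (induction k) simp_all

lemma laplacian_pow_degree_scale:
  "(laplacian ^^ k) (degree_scale a p) = degree_scale (\<lambda>s. a (s + 2 * k)) ((laplacian ^^ k) p)"
  by (induction k) (simp_all add: laplacian_degree_scale)

text \<open>Iterates the previous commutator, moving each \<Delta> past a degree weight at the cost
  of a shift by 2. The weights are positive integers: cancellable in characteristic 0, which gives
  uniqueness of the projection, and invertible over the rationals, which gives existence.\<close>

lemma laplacian_pow_sq_norm_mult:
  fixes p :: "('n::finite, 'a::comm_ring_1) mpol"
  shows "(laplacian ^^ Suc k) (sq_norm * p) = sq_norm * (laplacian ^^ Suc k) p +
    degree_scale (\<lambda>s. of_nat (2 * Suc k * (2 * s + CARD('n) + 2 * k))) ((laplacian ^^ k) p)"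
proof (induction k)
  case 0
  show ?case by (simp add: laplacian_sq_norm_mult algebra_simps)
next
  case (Suc k)
  have "(laplacian ^^ Suc (Suc k)) (sq_norm * p) = laplacian ((laplacian ^^ Suc k) (sq_norm * p))"
    by simp
  also have "\<dots> = sq_norm * (laplacian ^^ Suc (Suc k)) p +
      (degree_scale (\<lambda>s. of_nat (4 * s + 2 * CARD('n))) ((laplacian ^^ Suc k) p) +
      degree_scale (\<lambda>s. of_nat (2 * Suc k * (2 * (s + 2) + CARD('n) + 2 * k)))
        ((laplacian ^^ Suc k) p))"
    unfolding Suc.IH laplacian_add laplacian_sq_norm_mult laplacian_degree_scale
    by (simp add: add.assoc)
  also have "degree_scale (\<lambda>s. of_nat (4 * s + 2 * CARD('n))) ((laplacian ^^ Suc k) p) +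
      degree_scale (\<lambda>s. of_nat (2 * Suc k * (2 * (s + 2) + CARD('n) + 2 * k)))
        ((laplacian ^^ Suc k) p) =
      degree_scale (\<lambda>s. of_nat (2 * Suc (Suc k) * (2 * s + CARD('n) + 2 * Suc k)))
        ((laplacian ^^ Suc k) p)"
    by (simp add: algebra_simps flip: degree_scale_plus)
  finally show ?case .
qed

lemma laplacian_pow_eq_0:
  assumes "\<And>m. mdeg m \<ge> k \<Longrightarrow> Poly_Mapping.lookup p m = 0"
  shows "(laplacian ^^ k) p = 0"
  using assms
proof (induction k arbitrary: p)
  case 0
  then show ?case by (auto intro: poly_mapping_eqI)
next
  case (Suc k)
  have "(laplacian ^^ k) (laplacian p) = 0"
  proof (rule Suc.IH)
    fix m :: "'a \<Rightarrow>\<^sub>0 nat"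
    assume "k \<le> mdeg m"
    then have "Poly_Mapping.lookup p (m + Poly_Mapping.single j 1 + Poly_Mapping.single j 1) = 0" for j
      by (intro Suc.prems) (simp add: mdeg_add)
    then show "Poly_Mapping.lookup (laplacian p) m = 0"
      by (simp add: laplacian_def lookup_sum lookup_mpderiv)
  qed
  then show ?case by (simp add: funpow_swap1)
qed

lemma laplacian_nilpotent: "\<exists>k. (laplacian ^^ k) p = 0"
proof -
  \<comment> \<open>A crude degree bound suffices: the sum of the degrees of all monomials dominates
    each of them.\<close>
  have "Poly_Mapping.lookup p m = 0" if "mdeg m \<ge> Suc (\<Sum>k\<in>Poly_Mapping.keys p. mdeg k)" for m
  proof (rule ccontr)
    assume "Poly_Mapping.lookup p m \<noteq> 0"
    then have "mdeg m \<le> (\<Sum>k\<in>Poly_Mapping.keys p. mdeg k)"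
      by (intro member_le_sum) (auto simp: in_keys_iff)
    with that show False by simp
  qed
  then show ?thesis by (blast intro: laplacian_pow_eq_0)
qed

text \<open>
  Applying \<open>\<Delta>\<^sup>K\<^sup>+\<^sup>1\<close> to the product, where \<open>\<Delta>\<^sup>K g\<close> is the last nonzero iterate, leaves
  \<open>\<Delta>\<^sup>K g\<close> with positive integer factors on its homogeneous parts.
\<close>

lemma harmonic_sphere_mult_eq_0:
  fixes g :: "('n::finite, 'a::{idom,ring_char_0}) mpol"
  assumes "harmonic ((sq_norm - mconst c) * g)"
  shows "g = 0"
proof (rule ccontr)
  assume "g \<noteq> 0"
  define k where "k = (LEAST k. (laplacian ^^ k) g = 0)"
  have k: "(laplacian ^^ k) g = 0"
    unfolding k_def by (rule LeastI_ex) (rule laplacian_nilpotent)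
  with \<open>g \<noteq> 0\<close> obtain l where l: "k = Suc l"
    by (cases k) auto
  have nz: "(laplacian ^^ l) g \<noteq> 0"
    using not_less_Least[of l "\<lambda>k. (laplacian ^^ k) g = 0"] l by (simp add: k_def)
  have "(laplacian ^^ Suc l) ((sq_norm - mconst c) * g) = 0"
    using assms by (simp only: funpow_Suc_right comp_apply harmonic_def laplacian_pow_0)
  then have "degree_scale (\<lambda>s. of_nat (2 * Suc l * (2 * s + CARD('n) + 2 * l)))
      ((laplacian ^^ l) g) = 0"
    using k unfolding l left_diff_distrib laplacian_pow_diff laplacian_pow_sq_norm_mult
      laplacian_pow_mconst_mult by simp
  then have "of_nat (2 * Suc l * (2 * mdeg m + CARD('n) + 2 * l)) *
      Poly_Mapping.lookup ((laplacian ^^ l) g) m = 0" for m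
    by (metis lookup_degree_scale lookup_zero)
  moreover have "(of_nat (2 * Suc l * (2 * mdeg m + CARD('n) + 2 * l)) :: 'a) \<noteq> 0"
    for m :: "'n \<Rightarrow>\<^sub>0 nat"
    by (simp only: of_nat_eq_0_iff) simp
  ultimately have "Poly_Mapping.lookup ((laplacian ^^ l) g) m = 0" for m
    using mult_eq_0_iff by blast
  then have "(laplacian ^^ l) g = 0"
    by (intro poly_mapping_eqI) simp
  with nz show False by simp
qed

section \<open>Harmonic decomposition and projection\<close>

lemma contains_rat_inverse_of_nat:
  assumes "contains_rat TYPE('a::comm_ring_1)"
  obtains recip :: "nat \<Rightarrow> 'a::comm_ring_1" where "\<And>k. k > 0 \<Longrightarrow> of_nat k * recip k = 1"
proof -
  obtain h :: "rat \<Rightarrow> 'a" where h: "h 1 = 1" "\<And>x y. h (x + y) = h x + h y"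
      "\<And>x y. h (x * y) = h x * h y"
    using assms unfolding contains_rat_def by blast
  have h0: "h 0 = 0"
    using h(2)[of 0 0] by simp
  have "h (of_nat k) = of_nat k" for k
    by (induction k) (simp_all add: h0 h)
  then have "of_nat k * h (1 / of_nat k) = 1" if "k > 0" for k
    using h(3)[of "of_nat k" "1 / of_nat k"] h(1) that by simp
  then show thesis by (rule that)
qed

text \<open>Induction on the number of Laplacians that annihilate \<open>p\<close>: subtracting a
  suitable multiple of \<rho> - c lowers this number by one, until a harmonic polynomial
  remains.\<close>

lemma harmonic_decomposition:
  fixes p :: "('n::finite, 'a::comm_ring_1) mpol"
  assumes "contains_rat TYPE('a)"
  obtains h g where "harmonic h" "p = h + (sq_norm - mconst c) * g"
proof -
  obtain recip :: "nat \<Rightarrow> 'a" where recip: "\<And>k. k > 0 \<Longrightarrow> of_nat k * recip k = 1"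
    using contains_rat_inverse_of_nat[OF assms] by blast
  have "\<exists>h g. harmonic h \<and> p = h + (sq_norm - mconst c) * g" if "(laplacian ^^ Suc k) p = 0"
    for k and p :: "('n, 'a) mpol"
    using that
  proof (induction k arbitrary: p)
    case 0
    then have "harmonic p \<and> p = p + (sq_norm - mconst c) * 0"
      by (simp add: harmonic_def)
    then show ?case by blast
  next
    case (Suc k)
    define b where "b s = 2 * Suc k * (2 * s + CARD('n) + 2 * k)" for s
    \<comment> \<open>Chosen so that \<Delta> to the power \<open>Suc k\<close> sends
      \<open>(sq_norm - mconst c) * g\<close> and \<open>p\<close> to the same polynomial:
      \<open>g\<close> itself is killed by that power, so only the commutator term with weight
      \<open>b\<close> survives. The shift by \<open>2 * k\<close> offsets the one from passing
      \<open>k\<close> Laplacians.\<close>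
    define g where "g = degree_scale (\<lambda>s. recip (b (s - 2 * k))) (laplacian p)"
    have "(laplacian ^^ Suc k) g = 0"
      using Suc.prems unfolding g_def laplacian_pow_degree_scale
      by (simp add: funpow_swap1)
    moreover have "degree_scale (\<lambda>s. of_nat (b s)) ((laplacian ^^ k) g) = (laplacian ^^ Suc k) p"
    proof -
      have "of_nat (b s) * recip (b s) = 1" for s
        by (rule recip) (simp add: b_def)
      then show ?thesis
        unfolding g_def laplacian_pow_degree_scale degree_scale_comp
        by (simp add: degree_scale_const funpow_swap1)
    qed
    ultimately have "(laplacian ^^ Suc k) (p - (sq_norm - mconst c) * g) = 0"
      unfolding left_diff_distrib laplacian_pow_diff laplacian_pow_sq_norm_mult
        laplacian_pow_mconst_mult b_def by simp
    then obtain h g' where "harmonic h"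
        "p - (sq_norm - mconst c) * g = h + (sq_norm - mconst c) * g'"
      using Suc.IH by blast
    then have "harmonic h \<and> p = h + (sq_norm - mconst c) * (g' + g)"
      by (simp add: algebra_simps)
    then show ?case by blast
  qed
  moreover obtain k where "(laplacian ^^ k) p = 0"
    using laplacian_nilpotent by blast
  then have "(laplacian ^^ Suc k) p = 0"
    by simp
  ultimately show thesis using that by blast
qed

lemma harmonic_add: "harmonic p \<Longrightarrow> harmonic q \<Longrightarrow> harmonic (p + q)"
  by (simp add: harmonic_def laplacian_add)

lemma harmonic_mconst_mult: "harmonic p \<Longrightarrow> harmonic (mconst a * p)"
  by (simp add: harmonic_def laplacian_mconst_mult)

text \<open>The difference of the two harmonic parts is a harmonic multiple of \<rho> - c, hence
  zero.\<close>

lemma harmonic_decomposition_unique: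
  fixes g :: "('n::finite, 'a::{idom,ring_char_0}) mpol"
  assumes "harmonic h" "harmonic h'"
    and "h + (sq_norm - mconst c) * g = h' + (sq_norm - mconst c) * g'"
  shows "h = h'"
proof -
  have "h' - h = (sq_norm - mconst c) * (g - g')"
    using assms(3) by (simp add: algebra_simps)
  moreover have "harmonic (h' - h)"
    using assms(1,2) by (simp add: harmonic_def laplacian_diff)
  ultimately have "g - g' = 0"
    using harmonic_sphere_mult_eq_0 by metis
  with assms(3) show ?thesis by simp
qed

text \<open>Resolves the definite description in \<open>harmonic_proj\<close>: by existence and
  uniqueness of the decomposition, reading off the harmonic part is a map with the required
  properties, and linearity forces any other such map to agree with it.\<close>

lemma harmonic_proj_eqI:
  fixes h :: "('n::finite, 'a::{idom,ring_char_0}) mpol"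
  assumes "contains_rat TYPE('a)" and "harmonic h"
  shows "harmonic_proj c (h + (sq_norm - mconst c) * g) = h"
proof -
  define L :: "('n, 'a) mpol \<Rightarrow> ('n, 'a) mpol" where
    "L p = (THE h. harmonic h \<and> (\<exists>g. p = h + (sq_norm - mconst c) * g))" for p
  have L_eq: "L (h + (sq_norm - mconst c) * g) = h" if "harmonic h" for h g
    unfolding L_def by (rule the_equality) (use that harmonic_decomposition_unique in blast)+
  have L: "is_harmonic_proj c L"
    unfolding is_harmonic_proj_def
  proof (intro conjI)
    show "module_hom (\<lambda>a p. mconst a * p) (\<lambda>a p. mconst a * p) L"
    proof
      fix p q :: "('n, 'a) mpol" and r :: 'a
      obtain h g h' g' where *: "harmonic h" "p = h + (sq_norm - mconst c) * g"
          "harmonic h'" "q = h' + (sq_norm - mconst c) * g'"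
        using harmonic_decomposition[OF assms(1)] by metis
      have "L ((h + h') + (sq_norm - mconst c) * (g + g')) = h + h'"
        by (intro L_eq harmonic_add *)
      moreover have "(h + h') + (sq_norm - mconst c) * (g + g') = p + q"
        by (simp add: * algebra_simps)
      ultimately show "L (p + q) = L p + L q"
        using * by (simp add: L_eq)
      have "L (mconst r * h + (sq_norm - mconst c) * (mconst r * g)) = mconst r * h"
        by (intro L_eq harmonic_mconst_mult *)
      moreover have "mconst r * h + (sq_norm - mconst c) * (mconst r * g) = mconst r * p"
        by (simp add: * algebra_simps)
      ultimately show "L (mconst r * p) = mconst r * L p"
        using * by (simp add: L_eq)
    qed (simp_all add: algebra_simps mconst_add mconst_mult)
    show "range L \<subseteq> {p. harmonic p}"
      using harmonic_decomposition[OF assms(1)] L_eq by (metis image_subsetI mem_Collect_eq)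
    show "\<forall>p. harmonic p \<longrightarrow> L p = p"
      using L_eq[where g = 0] by simp
    show "\<forall>p\<in>sphere_ideal c. L p = 0"
      using L_eq[where h = 0] by (auto simp: sphere_ideal_def harmonic_def simp flip: sq_norm_def)
  qed
  have "L' = L" if "is_harmonic_proj c L'" for L'
  proof
    fix p :: "('n, 'a) mpol"
    obtain h g where *: "harmonic h" "p = h + (sq_norm - mconst c) * g"
      using harmonic_decomposition[OF assms(1)] by metis
    interpret module_hom "\<lambda>a p. mconst a * p" "\<lambda>a p. mconst a * p" L'
      using that by (simp add: is_harmonic_proj_def)
    have "L' p = L' h + L' ((sq_norm - mconst c) * g)"
      using *(2) add by simp
    also have "\<dots> = h"
      using that *(1) by (auto simp: is_harmonic_proj_def sphere_ideal_def sq_norm_def)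
    finally show "L' p = L p"
      using * by (simp add: L_eq)
  qed
  with L have "harmonic_proj c = L"
    unfolding harmonic_proj_def by blast
  with assms(2) show ?thesis by (simp add: L_eq)
qed

section \<open>Differential operators on ridge polynomials\<close>

lemma ridge_0 [simp]: "ridge 0 t = 0"
  by (simp add: ridge_def)

lemma ridge_pCons:
  "ridge (pCons a q) t = mconst a + (\<Sum>j\<in>UNIV. mconst (t $ j) * mvar j) * ridge q t"
  by (simp add: ridge_def map_poly_pCons)

lemma ridge_add: "ridge (p + q) t = ridge p t + ridge q t"
  by (induction p q rule: poly_induct2) (simp_all add: ridge_pCons mconst_add algebra_simps)

lemma ridge_smult: "ridge (smult a q) t = mconst a * ridge q t"
  by (induction q) (simp_all add: ridge_pCons mconst_mult algebra_simps)

lemma ridge_diff: "ridge (p - q) t = ridge p t - ridge q t"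
  using ridge_add[of "p - q" q t] by simp

text \<open>The chain rule, by induction along the Horner form; the inner linear form has the
  constant derivative \<open>t $ j\<close>.\<close>

lemma mpderiv_ridge: "mpderiv j (ridge q t) = mconst (t $ j) * ridge (pderiv q) t"
proof (induction q)
  case (pCons a q)
  have "mpderiv j (\<Sum>k\<in>UNIV. mconst (t $ k) * mvar k) = (\<Sum>k\<in>UNIV. if j = k then mconst (t $ k) else 0)"
    unfolding mpderiv_sum
    by (intro sum.cong refl) (simp add: mpderiv_mult mpderiv_mvar)
  then have "mpderiv j (\<Sum>k\<in>UNIV. mconst (t $ k) * mvar k) = mconst (t $ j)"
    by simp
  with pCons.IH show ?case
    by (simp add: ridge_pCons mpderiv_add mpderiv_mult pderiv_pCons ridge_add algebra_simps)
qed simp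

lemma laplacian_ridge: "laplacian (ridge q t) = mconst (dot_self t) * ridge (pderiv (pderiv q)) t"
  by (simp add: laplacian_def mpderiv_mult mpderiv_ridge dot_self_def mconst_sum sum_distrib_right
      power2_eq_square mconst_mult mult.assoc)

text \<open>The Euler operator acts on ridge polynomials as \<open>Y d/dY\<close> acts on
  \<open>q\<close>.\<close>

lemma euler_ridge: "degree_scale of_nat (ridge q t) = ridge (pCons 0 (pderiv q)) t"
  unfolding euler[symmetric] mpderiv_ridge ridge_pCons
  by (simp add: sum_distrib_right mult.assoc mult.left_commute)

section \<open>Evaluation at points of the sphere\<close>

text \<open>Coefficients pass through \<open>\<phi>\<close> because the points to be used have
  coordinates in a larger field.\<close>

definition mpoly_eval :: "('a \<Rightarrow> 'b) \<Rightarrow> ('n \<Rightarrow> 'b) \<Rightarrow> ('n::finite, 'a::comm_ring_1) mpol \<Rightarrow> 'b::comm_ring_1"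
  where "mpoly_eval \<phi> x p =
    (\<Sum>m\<in>Poly_Mapping.keys p. \<phi> (Poly_Mapping.lookup p m) * (\<Prod>j\<in>UNIV. x j ^ Poly_Mapping.lookup m j))"

context
  fixes \<phi> :: "'a::comm_ring_1 \<Rightarrow> 'b::comm_ring_1" and x :: "'n::finite \<Rightarrow> 'b"
  assumes hom_1: "\<phi> 1 = 1"
    and hom_add: "\<And>a b. \<phi> (a + b) = \<phi> a + \<phi> b"
    and hom_mult: "\<And>a b. \<phi> (a * b) = \<phi> a * \<phi> b"
begin

lemma hom_0: "\<phi> 0 = 0"
  using hom_add[of 0 0] by simp

lemma mpoly_eval_superset:
  assumes "finite A" "Poly_Mapping.keys p \<subseteq> A"
  shows "mpoly_eval \<phi> x p =
    (\<Sum>m\<in>A. \<phi> (Poly_Mapping.lookup p m) * (\<Prod>j\<in>UNIV. x j ^ Poly_Mapping.lookup m j))"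
  unfolding mpoly_eval_def using assms
  by (intro sum.mono_neutral_left) (auto simp: in_keys_iff hom_0)

lemma mpoly_eval_add: "mpoly_eval \<phi> x (p + q) = mpoly_eval \<phi> x p + mpoly_eval \<phi> x q"
proof -
  let ?A = "Poly_Mapping.keys p \<union> Poly_Mapping.keys q"
  have "Poly_Mapping.keys (p + q) \<subseteq> ?A"
    by (rule Poly_Mapping.keys_add)
  then show ?thesis
    by (simp add: mpoly_eval_superset[of ?A] lookup_add hom_add distrib_right sum.distrib)
qed

lemma mpoly_eval_single:
  "mpoly_eval \<phi> x (Poly_Mapping.single m a) = \<phi> a * (\<Prod>j\<in>UNIV. x j ^ Poly_Mapping.lookup m j)"
  by (cases "a = 0") (simp_all add: mpoly_eval_def hom_0)

lemma mpoly_eval_mult: "mpoly_eval \<phi> x (p * q) = mpoly_eval \<phi> x p * mpoly_eval \<phi> x q"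
proof (induction p rule: mpol_induct)
  case (monomial m a)
  show ?case
    by (induction q rule: mpol_induct)
      (simp_all add: mult_single mpoly_eval_single mpoly_eval_add hom_mult lookup_add power_add
        prod.distrib algebra_simps)
qed (simp add: mpoly_eval_add algebra_simps)

lemma mpoly_eval_mconst: "mpoly_eval \<phi> x (mconst a) = \<phi> a"
  by (simp add: mconst_def mpoly_eval_single)

lemma mpoly_eval_diff: "mpoly_eval \<phi> x (p - q) = mpoly_eval \<phi> x p - mpoly_eval \<phi> x q"
  using mpoly_eval_add[of "p - q" q] by simp

lemma mpoly_eval_mvar: "mpoly_eval \<phi> x (mvar j) = x j"
proof -
  have "(\<Prod>k\<in>UNIV. x k ^ Poly_Mapping.lookup (Poly_Mapping.single j 1) k) =
      (\<Prod>k\<in>UNIV. if k = j then x k else 1)"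
    by (intro prod.cong) (auto simp: lookup_single when_def)
  then show ?thesis by (simp add: mvar_def mpoly_eval_single hom_1)
qed

lemma mpoly_eval_sum: "mpoly_eval \<phi> x (\<Sum>i\<in>A. f i) = (\<Sum>i\<in>A. mpoly_eval \<phi> x (f i))"
  by (induction A rule: infinite_finite_induct)
    (simp_all add: mpoly_eval_add mpoly_eval_def[of _ _ 0])

lemma mpoly_eval_sq_norm: "mpoly_eval \<phi> x sq_norm = (\<Sum>j\<in>UNIV. x j ^ 2)"
  by (simp add: sq_norm_def mpoly_eval_sum mpoly_eval_mult mpoly_eval_mvar power2_eq_square)

lemma mpoly_eval_ridge:
  "mpoly_eval \<phi> x (ridge q t) = poly (map_poly \<phi> q) (\<Sum>j\<in>UNIV. \<phi> (t $ j) * x j)"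
proof (induction q)
  case 0
  show ?case by (simp add: mpoly_eval_def)
next
  case (pCons a q)
  then show ?case
    by (simp add: ridge_pCons mpoly_eval_add mpoly_eval_mconst mpoly_eval_mult mpoly_eval_sum
        mpoly_eval_mvar map_poly_pCons hom_0)
qed

end

text \<open>
  Over an algebraically closed field the sphere contains the points
  \<open>((z + c/z)/2, (z - c/z)/(2i))\<close> in any coordinate plane, and for one of the two choices of \<open>i\<close>
  the linear form \<open>t \<cdot> X\<close> takes infinitely many values on them.
\<close>

lemma ridge_sphere_mult_eq_0:
  fixes q :: "'a::{idom,ring_char_0} poly" and t :: "'a ^ 'n::finite"
  assumes "CARD('n) \<ge> 2" and "t $ j \<noteq> 0"
    and "ridge q t = (sq_norm - mconst c) * g"
  shows "q = 0"
proof -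
  obtain k where "k \<noteq> j"
    using assms(1) by (metis card_2_iff' UNIV_I card_le_Suc0_iff_eq finite not_less_eq_eq numeral_2_eq_2)
  define \<phi> :: "'a \<Rightarrow> 'a fract alg_closure" where "\<phi> a = to_ac (to_fract a)" for a
  have hom: "\<phi> 1 = 1" "\<And>a b. \<phi> (a + b) = \<phi> a + \<phi> b" "\<And>a b. \<phi> (a * b) = \<phi> a * \<phi> b"
    and inj: "\<phi> a = \<phi> b \<longleftrightarrow> a = b" for a b
    by (simp_all add: \<phi>_def)
  have phi_0: "\<phi> a = 0 \<longleftrightarrow> a = 0" for a
    by (simp add: \<phi>_def)
  have "\<phi> (1 + 1) = 2"
    unfolding hom by simp
  then have two: "(2 :: 'a fract alg_closure) \<noteq> 0"
    using phi_0[of 2] by auto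
  obtain i0 :: "'a fract alg_closure" where "i0 ^ 2 = -1"
    using nth_root_exists[of 2 "-1"] by auto
  then obtain i :: "'a fract alg_closure" where i: "i ^ 2 = -1" "\<phi> (t $ j) - i * \<phi> (t $ k) \<noteq> 0"
  \<comment> \<open>If \<open>i0\<close> makes the expression vanish, then \<open>- i0\<close> gives
    twice \<open>\<phi> (t $ j)\<close>, which is nonzero.\<close>
  proof (cases "\<phi> (t $ j) - i0 * \<phi> (t $ k) = 0")
    case True
    then have "\<phi> (t $ j) - (- i0) * \<phi> (t $ k) = 2 * \<phi> (t $ j)"
      by (simp add: algebra_simps)
    also have "\<dots> \<noteq> 0"
      using two phi_0 assms(2) by simp
    finally show thesis
      using that[of "- i0"] \<open>i0 ^ 2 = -1\<close> by simp
  qed auto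
  \<comment> \<open>The linear form takes the value \<alpha> z + \<beta> / z at the point with
    parameter \<open>z\<close>; the choice of \<open>i\<close> makes \<alpha> nonzero.\<close>
  define \<alpha> \<beta> where "\<alpha> = (\<phi> (t $ j) - i * \<phi> (t $ k)) / 2"
    and "\<beta> = (\<phi> (t $ j) + i * \<phi> (t $ k)) / 2 * \<phi> c"
  have root: "poly (map_poly \<phi> q) (\<alpha> * z + \<beta> / z) = 0" if "z \<noteq> 0" for z
  proof -
    define w where "w = \<phi> c / z"
    have zw: "z * w = \<phi> c"
      using that by (simp add: w_def)
    \<comment> \<open>Chosen so that \<open>u + i * v = z\<close> and \<open>u - i * v = w\<close>,
      whence the squares of \<open>u\<close> and \<open>v\<close> sum to
      \<open>z * w\<close>.\<close>
    define u v where "u = (z + w) / 2" and "v = - i * (z - w) / 2"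
    define x where "x l = (if l = j then u else if l = k then v else 0)" for l
    have sum_x: "(\<Sum>l\<in>UNIV. f l (x l)) = f j u + f k v" if "\<And>l. f l 0 = 0"
      for f :: "'n \<Rightarrow> 'a fract alg_closure \<Rightarrow> 'a fract alg_closure"
    proof -
      have "(\<Sum>l\<in>UNIV. f l (x l)) = (\<Sum>l\<in>{j, k}. f l (x l))"
        by (rule sum.mono_neutral_right) (auto simp: x_def that)
      with \<open>k \<noteq> j\<close> show ?thesis by (simp add: x_def)
    qed
    have "u ^ 2 + v ^ 2 = ((z + w) ^ 2 - (z - w) ^ 2) / 2 ^ 2"
      by (simp add: u_def v_def power_divide power_mult_distrib i(1) diff_divide_distrib)
    also have "(z + w) ^ 2 - (z - w) ^ 2 = 2 ^ 2 * (z * w)"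
      by (simp add: power2_eq_square algebra_simps)
    also have "2 ^ 2 * (z * w) / 2 ^ 2 = \<phi> c"
      unfolding zw using two by (intro nonzero_mult_div_cancel_left power_not_zero)
    finally have "(\<Sum>l\<in>UNIV. x l ^ 2) = \<phi> c"
      using sum_x[of "\<lambda>_ y. y ^ 2"] by simp
    then have "mpoly_eval \<phi> x ((sq_norm - mconst c) * g) = 0"
      by (simp add: mpoly_eval_mult[OF hom] mpoly_eval_diff[OF hom] mpoly_eval_sq_norm[OF hom]
          mpoly_eval_mconst[OF hom])
    moreover have "(\<Sum>l\<in>UNIV. \<phi> (t $ l) * x l) = \<alpha> * z + \<beta> / z"
    proof -
      have "(\<Sum>l\<in>UNIV. \<phi> (t $ l) * x l) = \<phi> (t $ j) * u + \<phi> (t $ k) * v"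
        by (rule sum_x) simp
      also have "\<dots> = (\<phi> (t $ j) * (z + w) + \<phi> (t $ k) * (- i * (z - w))) / 2"
        by (simp add: u_def v_def add_divide_distrib)
      also have "\<phi> (t $ j) * (z + w) + \<phi> (t $ k) * (- i * (z - w)) =
          (\<phi> (t $ j) - i * \<phi> (t $ k)) * z + (\<phi> (t $ j) + i * \<phi> (t $ k)) * w"
        by (simp add: algebra_simps)
      also have "\<dots> / 2 = (\<phi> (t $ j) - i * \<phi> (t $ k)) / 2 * z +
          (\<phi> (t $ j) + i * \<phi> (t $ k)) / 2 * w"
        unfolding add_divide_distrib[of "_ * z"] by simp
      also have "\<dots> = \<alpha> * z + \<beta> / z"
        by (simp add: \<alpha>_def \<beta>_def w_def)
      finally show ?thesis .
    qed
    ultimately show ?thesis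
      using assms(3) mpoly_eval_ridge[OF hom, of x q t] by simp
  qed
  show "q = 0"
  proof (rule ccontr)
    assume "q \<noteq> 0"
    then have "map_poly \<phi> q \<noteq> 0"
      by (metis coeff_map_poly leading_coeff_0_iff phi_0 coeff_0)
    then have fin: "finite {w. poly (map_poly \<phi> q) w = 0}"
      by (rule poly_roots_finite)
    \<comment> \<open>Each nonzero \<open>z\<close> solves a quadratic determined by the value
      \<open>w\<close> of the linear form, and \<open>w\<close> is a root of the image of
      \<open>q\<close>. Finitely many roots \<open>w\<close>, with finitely many \<open>z\<close>
      each because \<alpha> is nonzero, would make the field finite.\<close>
    have "- {0} \<subseteq> (\<Union>w\<in>{w. poly (map_poly \<phi> q) w = 0}. {z. poly [:\<beta>, - w, \<alpha>:] z = 0})"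
    proof
      fix z :: "'a fract alg_closure"
      assume "z \<in> - {0}"
      then have "poly [:\<beta>, - (\<alpha> * z + \<beta> / z), \<alpha>:] z = 0"
        by (simp add: field_simps)
      with root[of z] \<open>z \<in> - {0}\<close>
      show "z \<in> (\<Union>w\<in>{w. poly (map_poly \<phi> q) w = 0}. {z. poly [:\<beta>, - w, \<alpha>:] z = 0})"
        by blast
    qed
    moreover have "finite {z. poly [:\<beta>, - w, \<alpha>:] z = 0}" for w
      using two i(2) by (intro poly_roots_finite) (simp add: \<alpha>_def)
    ultimately have "finite (- {0 :: 'a fract alg_closure})"
      using fin by (meson finite_UN_I finite_subset)
    then have "finite (UNIV :: 'a fract alg_closure set)"
      by simp
    then have "finite (range (\<lambda>n. \<phi> (of_nat n)))"
      by (rule rev_finite_subset) simp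
    moreover have "inj (\<lambda>n. \<phi> (of_nat n))"
      by (simp add: inj_def inj)
    ultimately show False
      using range_inj_infinite by blast
  qed
qed

section \<open>Degree eigenvalues and the differential equation\<close>

text \<open>For N at least 2 the map \<open>s * (s + N - 2)\<close> is strictly increasing on
  natural numbers, so the eigenvalue determines the degree. Writing N as \<open>M + 2\<close> avoids
  truncated subtraction.\<close>

lemma degree_eigenvalue_eq_iff:
  assumes "N \<ge> 2"
  shows "of_nat s * (of_nat s + of_nat N - 2) = (of_nat n * (of_nat n + of_nat N - 2) :: 'a::{idom,ring_char_0})
    \<longleftrightarrow> s = n"
proof
  assume eq: "of_nat s * (of_nat s + of_nat N - 2) = (of_nat n * (of_nat n + of_nat N - 2) :: 'a)"
  obtain M where N: "N = M + 2"
    using assms le_Suc_ex by (metis add.commute)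
  have "of_nat (s * (s + M)) = (of_nat (n * (n + M)) :: 'a)"
    using eq by (simp add: N)
  then have "s * (s + M) = n * (n + M)"
    by (simp only: of_nat_eq_iff)
  moreover have "s * (s + M) < n * (n + M)" if "s < n" for s n
    using that by (intro mult_strict_mono') auto
  ultimately show "s = n"
    by (metis less_irrefl linorder_neqE_nat)
qed simp

text \<open>The eigenvector equation is compared coefficient by coefficient; in a domain a nonzero
  coefficient cancels, leaving equality of eigenvalues.\<close>

lemma homogeneous_of_degree_iff_degree_scale:
  fixes h :: "('n::finite, 'a::{idom,ring_char_0}) mpol"
  assumes "CARD('n) \<ge> 2"
  shows "homogeneous_of_degree n h \<longleftrightarrow> h \<noteq> 0 \<and>
    degree_scale (\<lambda>s. of_nat s * (of_nat s + of_nat CARD('n) - 2)) h =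
    mconst (of_nat n * (of_nat n + of_nat CARD('n) - 2)) * h"
proof -
  have "degree_scale (\<lambda>s. of_nat s * (of_nat s + of_nat CARD('n) - 2)) h =
      mconst (of_nat n * (of_nat n + of_nat CARD('n) - 2)) * h \<longleftrightarrow>
    (\<forall>m. of_nat (mdeg m) * (of_nat (mdeg m) + of_nat CARD('n) - 2) * Poly_Mapping.lookup h m =
      of_nat n * (of_nat n + of_nat CARD('n) - 2) * Poly_Mapping.lookup h m)"
    by (simp only: poly_mapping_eq_iff fun_eq_iff lookup_degree_scale lookup_mconst_mult)
  also have "\<dots> \<longleftrightarrow> (\<forall>m. Poly_Mapping.lookup h m \<noteq> 0 \<longrightarrow> mdeg m = n)"
    by (simp only: mult_cancel_right degree_eigenvalue_eq_iff[OF assms]) blast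
  also have "\<dots> \<longleftrightarrow> (\<forall>m\<in>Poly_Mapping.keys h. (\<Sum>j\<in>UNIV. Poly_Mapping.lookup m j) = n)"
    by (auto simp: in_keys_iff mdeg_def)
  finally show ?thesis
    by (simp only: homogeneous_of_degree_def)
qed

theorem proposition5p6:
  fixes q :: "'a::{idom,ring_char_0} poly"
    and t :: "'a ^ 'n::finite"
    and c :: 'a
    and n :: nat
  assumes "contains_rat TYPE('a)"
    and "CARD('n) \<ge> 2"
    and "q \<noteq> 0"
    and "\<exists>j. t $ j \<noteq> 0"
  shows "homogeneous_of_degree n (harmonic_proj c (ridge q t)) \<longleftrightarrow>
    ([:dot_self t * c:] - [:0, 1:] ^ 2) * pderiv (pderiv q)
      - smult (of_nat CARD('n) - 1) ([:0, 1:] * pderiv q)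
      + smult (of_nat n * (of_nat n + of_nat CARD('n) - 2)) q = 0"
    (is "_ \<longleftrightarrow> ?r = 0")
proof -
  obtain j where j: "t $ j \<noteq> 0"
    using assms(4) by blast
  obtain h g where h: "harmonic h" and q: "ridge q t = h + (sq_norm - mconst c) * g"
    using harmonic_decomposition[OF assms(1)] by metis
  have proj: "harmonic_proj c (ridge q t) = h"
    unfolding q using assms(1) h by (rule harmonic_proj_eqI)
  \<comment> \<open>Otherwise \<rho> - c would divide the nonzero ridge polynomial.\<close>
  have "h \<noteq> 0"
    using ridge_sphere_mult_eq_0[OF assms(2) j] q assms(3) by auto
  define e :: "nat \<Rightarrow> 'a" where "e s = of_nat s * (of_nat s + of_nat CARD('n) - 2)" for s
  \<comment> \<open>The spherical Laplacian shifted by \<open>e n\<close>, so that homogeneity of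
    degree \<open>n\<close> of \<open>h\<close> becomes vanishing of
    \<open>\<Lambda> h\<close>.\<close>
  define \<Lambda> :: "('n, 'a) mpol \<Rightarrow> ('n, 'a) mpol"
    where "\<Lambda> p = sq_norm * laplacian p - degree_scale e p + mconst (e n) * p" for p
  have Lambda_add: "\<Lambda> (p + p') = \<Lambda> p + \<Lambda> p'" for p p'
    by (simp add: \<Lambda>_def laplacian_add degree_scale_add algebra_simps)
  have Lambda_sphere: "\<Lambda> ((sq_norm - mconst c) * p) = (sq_norm - mconst c) * \<Lambda> p" for p
  proof -
    \<comment> \<open>The increment \<open>e (s + 2) - e s = 4 s + 2 N\<close> is exactly the
      commutator of \<Delta> with \<rho>, so the two corrections cancel.\<close>
    have "degree_scale (\<lambda>s. e (s + 2)) p =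
        degree_scale e p + degree_scale (\<lambda>s. of_nat (4 * s + 2 * CARD('n))) p"
      unfolding degree_scale_plus[symmetric] by (simp add: e_def algebra_simps)
    then show ?thesis
      by (simp add: \<Lambda>_def left_diff_distrib laplacian_diff degree_scale_diff laplacian_mconst_mult
          laplacian_sq_norm_mult degree_scale_sq_norm_mult degree_scale_mconst_mult)
        (simp add: algebra_simps)
  qed
  \<comment> \<open>With \<open>D = Y d/dY\<close>, the operator \<open>D (D + N - 2)\<close> sends
    \<open>q\<close> to this polynomial.\<close>
  define A where "A = pCons 0 (pCons 0 (pderiv (pderiv q))) +
    smult (of_nat CARD('n) - 1) (pCons 0 (pderiv q))"
  have scale_ridge: "degree_scale e (ridge q t) = ridge A t"
  proof -
    have "degree_scale e (ridge q t) = degree_scale of_nat (degree_scale of_nat (ridge q t)) +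
        mconst (of_nat CARD('n) - 2) * degree_scale of_nat (ridge q t)"
      unfolding degree_scale_const[symmetric] degree_scale_comp degree_scale_plus[symmetric]
      by (simp add: e_def[abs_def] algebra_simps)
    also have "\<dots> = ridge (pCons 0 (pderiv (pCons 0 (pderiv q))) +
        smult (of_nat CARD('n) - 2) (pCons 0 (pderiv q))) t"
      unfolding euler_ridge ridge_add ridge_smult ..
    also have "pCons 0 (pderiv (pCons 0 (pderiv q))) + smult (of_nat CARD('n) - 2) (pCons 0 (pderiv q)) =
        pCons 0 (pCons 0 (pderiv (pderiv q))) + smult (of_nat CARD('n) - 1) (pCons 0 (pderiv q))"
      by (simp add: pderiv_pCons smult_diff_left numeral_mult_conv_smult)
    finally show ?thesis unfolding A_def .
  qed
  have "?r = smult (dot_self t * c) (pderiv (pderiv q)) - A + smult (e n) q"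
    by (simp add: A_def e_def power2_eq_square algebra_simps)
  then have "ridge ?r t = mconst c * laplacian (ridge q t) - degree_scale e (ridge q t) +
      mconst (e n) * ridge q t"
    by (simp only: ridge_add ridge_diff ridge_smult laplacian_ridge scale_ridge mconst_mult mult_ac)
  \<comment> \<open>The equation has \<open>c\<close> where \<open>\<Lambda>\<close> has \<rho>;
    exchanging them costs a multiple of \<rho> - c.\<close>
  then have "ridge ?r t = \<Lambda> (ridge q t) - (sq_norm - mconst c) * laplacian (ridge q t)"
    by (simp only: \<Lambda>_def) (simp add: left_diff_distrib)
  also have "\<dots> = \<Lambda> h + (sq_norm - mconst c) * (\<Lambda> g - laplacian (ridge q t))"
    by (subst q) (simp add: Lambda_add Lambda_sphere right_diff_distrib)
  finally obtain g' where r: "ridge ?r t = \<Lambda> h + (sq_norm - mconst c) * g'"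
    by blast
  have Lambda_h: "\<Lambda> h = mconst (e n) * h - degree_scale e h"
    using h by (simp add: \<Lambda>_def harmonic_def)
  \<comment> \<open>Degree weights preserve harmonicity, since \<Delta> merely shifts them.\<close>
  have "harmonic (\<Lambda> h)"
    using h by (simp add: Lambda_h harmonic_def laplacian_diff laplacian_mconst_mult
        laplacian_degree_scale)
  \<comment> \<open>If \<open>\<Lambda> h\<close> vanishes, \<rho> - c divides the ridge polynomial
    of \<open>?r\<close>, so \<open>?r = 0\<close>. Conversely, \<open>?r = 0\<close> leaves two
    decompositions of 0, and uniqueness gives \<open>\<Lambda> h = 0\<close>.\<close>
  then have "\<Lambda> h = 0 \<longleftrightarrow> ?r = 0"
    using ridge_sphere_mult_eq_0[OF assms(2) j, of ?r c g'] r
      harmonic_decomposition_unique[of "\<Lambda> h" 0 c g' 0] ridge_0[of t]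
    by (auto simp: harmonic_def)
  moreover have "homogeneous_of_degree n h \<longleftrightarrow> \<Lambda> h = 0"
    using \<open>h \<noteq> 0\<close> homogeneous_of_degree_iff_degree_scale[OF assms(2), of n h]
    unfolding Lambda_h e_def by auto
  ultimately show ?thesis
    unfolding proj by simp
qed

end
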